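(* We have the equivalence $$Z\neq\varnothing\quad\Leftrightarrow\quad \mu^*=-\mu\in\mathbb{R}\ \text{ and both infima defining } \mu \text{ and } \mu^* \text{ are attained},$$ in which case $Z=\operatorname{argmin}(f+g\circ L)$.
   Context: $X$ and $Y$ are real Hilbert spaces, $L\colon X\to Y$ is continuous and linear with adjoint $L^*$, and $f\colon X\to\left]-\infty,+\infty\right]$ and $g\colon Y\to\left]-\infty,+\infty\right]$ are convex, lower semicontinuous, and proper. $\partial$ denotes the convex subdifferential and $f^*,g^*$ the Fenchel conjugates. Set $$Z:=\{x\in X: 0\in\partial f(x)+L^*\partial g(Lx)\},$$ $$\mu:=\inf_{x\in X}\big(f(x)+g(Lx)\big),\qquad \mu^*:=\inf_{y\in Y}\big(g^*(y)+f^*(-L^*y)\big).$$ *)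

theory Defs
  imports "HOL-Analysis.Analysis"
begin

text \<open>
  Functions with values in \<open>]-\<infinity>, +\<infinity>]\<close> are rendered as \<^typ>\<open>ereal\<close>-valued functions. The value
  \<open>-\<infinity>\<close> is excluded by \<open>proper\<close>, so that the sums \<open>f x + g (L x)\<close> below never meet \<open>\<infinity> - \<infinity>\<close>.
\<close>

definition proper :: "('a \<Rightarrow> ereal) \<Rightarrow> bool" where
  "proper f \<longleftrightarrow> (\<forall>x. f x \<noteq> -\<infinity>) \<and> (\<exists>x. f x \<noteq> \<infinity>)"

text \<open>The library's \<^const>\<open>convex_on\<close> and \<^const>\<open>epigraph\<close> cover real-valued functions only.\<close>

definition convex_fun :: "('a::real_vector \<Rightarrow> ereal) \<Rightarrow> bool" where
  "convex_fun f \<longleftrightarrow> convex {(x, r :: real). f x \<le> ereal r}"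

definition lsc :: "('a::topological_space \<Rightarrow> ereal) \<Rightarrow> bool" where
  "lsc f \<longleftrightarrow> (\<forall>x. f x \<le> Liminf (nhds x) f)"

text \<open>For proper \<open>f\<close> the subdifferential is empty at points where \<open>f\<close> is \<open>\<infinity>\<close>.\<close>

definition subdifferential :: "('a::real_inner \<Rightarrow> ereal) \<Rightarrow> 'a \<Rightarrow> 'a set" where
  "subdifferential f x = {u. \<forall>y. f x + ereal ((y - x) \<bullet> u) \<le> f y}"

definition conjugate :: "('a::real_inner \<Rightarrow> ereal) \<Rightarrow> 'a \<Rightarrow> ereal" where
  "conjugate f u = (SUP x. ereal (x \<bullet> u) - f x)"

definition argmin :: "('a \<Rightarrow> ereal) \<Rightarrow> 'a set" where
  "argmin h = {x. is_arg_min h (\<lambda>_. True) x}"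

text \<open>
  The sum in \<open>primal_solutions\<close> is the Minkowski sum of sets. The library's \<^const>\<open>adjoint\<close> is a
  choice of some \<open>L'\<close> with \<open>L x \<bullet> y = x \<bullet> L' y\<close> for all \<open>x\<close> and \<open>y\<close>; for bounded linear maps between
  Hilbert spaces such a map exists by Riesz representation and is unique.
\<close>

definition primal_solutions ::
    "('a::real_inner \<Rightarrow> ereal) \<Rightarrow> ('b::real_inner \<Rightarrow> ereal) \<Rightarrow> ('a \<Rightarrow> 'b) \<Rightarrow> 'a set" where
  "primal_solutions f g L = {x. 0 \<in> subdifferential f x + adjoint L ` subdifferential g (L x)}"

definition primal_value ::
    "('a::real_inner \<Rightarrow> ereal) \<Rightarrow> ('b::real_inner \<Rightarrow> ereal) \<Rightarrow> ('a \<Rightarrow> 'b) \<Rightarrow> ereal" where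
  "primal_value f g L = (INF x. f x + g (L x))"

definition dual_value ::
    "('a::real_inner \<Rightarrow> ereal) \<Rightarrow> ('b::real_inner \<Rightarrow> ereal) \<Rightarrow> ('a \<Rightarrow> 'b) \<Rightarrow> ereal" where
  "dual_value f g L = (INF y. conjugate g y + conjugate f (- adjoint L y))"

end

theory Submission
  imports Defs
begin

text \<open>
  Write \<open>p x = f x + g (L x)\<close> and \<open>d y = g\<^sup>* y + f\<^sup>* (- L\<^sup>* y)\<close>. The Fenchel--Young inequality
  \<open>x \<bullet> u \<le> f x + f\<^sup>* u\<close> is an equality exactly when \<open>u\<close> is a subgradient of \<open>f\<close> at \<open>x\<close>. Adding
  the instance for \<open>f\<close> at \<open>(x, - L\<^sup>* y)\<close> to the instance for \<open>g\<close> at \<open>(L x, y)\<close>, the two inner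
  products cancel, so \<open>0 \<le> p x + d y\<close>. This vanishes if and only if both instances are equalities,
  that is, if and only if \<open>- L\<^sup>* y \<in> \<partial>f x\<close> and \<open>y \<in> \<partial>g (L x)\<close>
  (\<open>weak_duality\<close>, \<open>zero_gap_iff_subgradients\<close>).

  With \<open>Z = primal_solutions f g L\<close>, membership \<open>x \<in> Z\<close> therefore says precisely
  that some \<open>y\<close> closes the gap at \<open>x\<close> (\<open>mem_primal_solutions_iff\<close>).
  Since \<open>p x' + d y' \<ge> 0\<close> for all pairs, a pair with zero gap consists of a minimiser of \<open>p\<close> and a
  minimiser of \<open>d\<close>, with finite optimal values that are opposite to each other. Conversely, if the
  optimal values are real and opposite, then any minimiser of \<open>p\<close> and any minimiser of \<open>d\<close> form a
  pair with zero gap. This gives the equivalence, and it also shows that one dual minimiser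
  serves every primal minimiser, whence \<open>Z = argmin p\<close>.

  The cancellation needs \<open>L x \<bullet> y = x \<bullet> L\<^sup>* y\<close>, hence the existence of the adjoint. This is where
  completeness enters, through the Riesz representation theorem.
\<close>

section \<open>Riesz representation and the adjoint\<close>

text \<open>
  The representing vector is the minimiser of the strictly convex functional
  \<open>J x = x \<bullet> x - 2 * \<phi> x\<close>. By the parallelogram law every minimising sequence of \<open>J\<close> is Cauchy, and
  at the limit the first variation of \<open>J\<close> vanishes in every direction.
\<close>

lemma riesz_representation:
  fixes \<phi> :: "'a::{real_inner, complete_space} \<Rightarrow> real"
  assumes "bounded_linear \<phi>"
  shows "\<exists>u. \<forall>x. \<phi> x = x \<bullet> u"
proof -
  interpret \<phi>: bounded_linear \<phi> by fact
  define J where "J x = x \<bullet> x - 2 * \<phi> x" for x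
  obtain K where K: "\<And>x. norm (\<phi> x) \<le> norm x * K"
    using \<phi>.bounded by blast
  have "- K\<^sup>2 \<le> J x" for x
  proof -
    have "0 \<le> (norm x - K)\<^sup>2" by simp
    then show ?thesis
      using K[of x] by (simp add: J_def dot_square_norm power2_diff abs_le_iff)
  qed
  then have bdd: "bdd_below (range J)"
    by (intro bdd_belowI2)
  define m where "m = (INF x. J x)"
  have m: "m \<le> J x" for x
    unfolding m_def using bdd by (simp add: cINF_lower)
  have "\<exists>x. J x < m + 1 / real (Suc n)" for n
  proof -
    have "(INF x. J x) < m + 1 / real (Suc n)"
      by (simp add: m_def)
    then show ?thesis
      using bdd by (subst (asm) cINF_less_iff) auto
  qed
  then obtain X where X: "\<And>n. J (X n) < m + 1 / real (Suc n)"
    by metis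
  \<comment> \<open>The parallelogram law in terms of \<open>J\<close>, with \<open>J\<close> at the midpoint of \<open>x\<close> and \<open>y\<close> bounded
    below by \<open>m\<close>.\<close>
  have parallelogram: "(dist x y)\<^sup>2 \<le> 2 * (J x - m) + 2 * (J y - m)" for x y
  proof -
    have "(dist x y)\<^sup>2 = 2 * J x + 2 * J y - 4 * J ((1/2) *\<^sub>R (x + y))"
      unfolding J_def dist_norm power2_norm_eq_inner \<phi>.scaleR \<phi>.add
      by (simp add: algebra_simps inner_commute)
    then show ?thesis
      using m[of "(1/2) *\<^sub>R (x + y)"] by simp
  qed
  have "Cauchy X"
  proof (rule metric_CauchyI)
    fix e :: real assume "e > 0"
    then obtain N where N: "inverse (real (Suc N)) < e\<^sup>2 / 4"
      using reals_Archimedean[of "e\<^sup>2 / 4"] by auto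
    have "dist (X i) (X j) < e" if "i \<ge> N" "j \<ge> N" for i j
    proof -
      have small: "J (X k) - m < e\<^sup>2 / 4" if "k \<ge> N" for k
      proof -
        have "1 / real (Suc k) \<le> inverse (real (Suc N))"
          using that by (simp add: field_simps)
        then show ?thesis using X[of k] N by linarith
      qed
      have "(dist (X i) (X j))\<^sup>2 < e\<^sup>2"
        using parallelogram[of "X i" "X j"] small[OF that(1)] small[OF that(2)]
        by (simp add: field_simps)
      then show ?thesis
        using \<open>e > 0\<close> by (simp add: power2_less_imp_less)
    qed
    then show "\<exists>M. \<forall>i\<ge>M. \<forall>j\<ge>M. dist (X i) (X j) < e" by blast
  qed
  then obtain u where u: "X \<longlonglongrightarrow> u"
    using Cauchy_convergent convergent_def by blast
  have "(\<lambda>n. J (X n)) \<longlonglongrightarrow> J u"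
    unfolding J_def by (intro tendsto_intros u \<phi>.tendsto)
  moreover have "(\<lambda>n. m + 1 / real (Suc n)) \<longlonglongrightarrow> m + 0"
    by (intro tendsto_intros LIMSEQ_Suc[OF lim_1_over_n])
  ultimately have "J u \<le> m + 0"
    by (rule LIMSEQ_le) (use X less_imp_le in blast)
  then have min: "J u \<le> J x" for x
    using m[of x] by simp
  have "\<phi> x = x \<bullet> u" for x
  proof (cases "x = 0")
    case False
    define c where "c = \<phi> x - x \<bullet> u"
    \<comment> \<open>This step minimises the quadratic polynomial \<open>t \<mapsto> J (u + t *\<^sub>R x)\<close>.\<close>
    define t where "t = c / (x \<bullet> x)"
    have "J (u + t *\<^sub>R x) = J u - 2 * t * c + t * (t * (x \<bullet> x))"
      unfolding J_def c_def \<phi>.add \<phi>.scaleR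
      by (simp add: algebra_simps inner_commute)
    also have "t * (x \<bullet> x) = c"
      using False by (simp add: t_def)
    finally have "t * c \<le> 0"
      using min[of "u + t *\<^sub>R x"] by (simp add: mult.commute)
    then have "c * c / (x \<bullet> x) \<le> 0"
      by (simp add: t_def)
    moreover have "x \<bullet> x > 0" using False by simp
    ultimately have "c * c \<le> 0"
      by (simp add: divide_le_0_iff)
    then have "c = 0"
      by (auto simp: mult_le_0_iff)
    then show ?thesis by (simp add: c_def)
  qed (simp add: \<phi>.zero)
  then show ?thesis by blast
qed

lemma adjoint_bounded_linear:
  fixes L :: "'a::{real_inner, complete_space} \<Rightarrow> 'b::real_inner"
  assumes "bounded_linear L"
  shows "L x \<bullet> y = x \<bullet> adjoint L y"
proof -
  have "\<exists>u. \<forall>x. L x \<bullet> y = x \<bullet> u" for y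
    using assms by (intro riesz_representation bounded_linear_compose[OF bounded_linear_inner_left])
  then have "\<exists>L'. \<forall>x y. L x \<bullet> y = x \<bullet> L' y"
    by metis
  then have "\<forall>x y. L x \<bullet> y = x \<bullet> adjoint L y"
    unfolding adjoint_def by (rule someI_ex)
  then show ?thesis by blast
qed

section \<open>The Fenchel--Young inequality\<close>

lemma proper_not_MInfty: "proper f \<Longrightarrow> f x \<noteq> -\<infinity>"
  by (simp add: proper_def)

text \<open>Properness supplies a point \<open>x\<close> with \<open>f x \<noteq> \<infinity>\<close>, whose term in the supremum is not \<open>-\<infinity>\<close>.\<close>

lemma conjugate_not_MInfty:
  assumes "proper f"
  shows "conjugate f u \<noteq> -\<infinity>"
proof -
  obtain x where "f x \<noteq> \<infinity>" using assms by (auto simp: proper_def)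
  then have "ereal (x \<bullet> u) - f x \<noteq> -\<infinity>"
    by (cases "f x") auto
  moreover have "ereal (x \<bullet> u) - f x \<le> conjugate f u"
    unfolding conjugate_def by (rule SUP_upper) simp
  ultimately show ?thesis by auto
qed

lemma fenchel_young:
  assumes "proper f"
  shows "ereal (x \<bullet> u) \<le> f x + conjugate f u"
proof -
  have "ereal (x \<bullet> u) - f x \<le> conjugate f u"
    unfolding conjugate_def by (rule SUP_upper) simp
  then show ?thesis
    using proper_not_MInfty[OF assms, of x] conjugate_not_MInfty[OF assms, of u]
    by (cases "f x"; cases "conjugate f u") auto
qed

text \<open>
  For real \<open>f x\<close>, both sides state that \<open>y \<bullet> u - f y \<le> x \<bullet> u - f x\<close> for every \<open>y\<close>, that is, that
  the supremum defining \<open>conjugate f u\<close> is attained at \<open>x\<close>. If \<open>f x = \<infinity>\<close>, both sides are false.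
\<close>

lemma subdifferential_iff_fenchel_young_eq:
  assumes "proper f"
  shows "u \<in> subdifferential f x \<longleftrightarrow> f x + conjugate f u = ereal (x \<bullet> u)"
proof (cases "f x")
  case (real a)
  have "f x + conjugate f u = ereal (x \<bullet> u) \<longleftrightarrow> conjugate f u \<le> ereal (x \<bullet> u - a)"
    using fenchel_young[OF assms, of x u] real by (cases "conjugate f u") auto
  also have "\<dots> \<longleftrightarrow> (\<forall>y. ereal (y \<bullet> u) - f y \<le> ereal (x \<bullet> u - a))"
    by (simp add: conjugate_def SUP_le_iff)
  also have "\<dots> \<longleftrightarrow> (\<forall>y. f x + ereal ((y - x) \<bullet> u) \<le> f y)"
  proof (intro all_cong1)
    fix y
    show "ereal (y \<bullet> u) - f y \<le> ereal (x \<bullet> u - a) \<longleftrightarrow> f x + ereal ((y - x) \<bullet> u) \<le> f y"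
      using real proper_not_MInfty[OF assms, of y]
      by (cases "f y") (auto simp: inner_diff_left)
  qed
  finally show ?thesis by (simp add: subdifferential_def)
next
  case PInf
  obtain y where "f y \<noteq> \<infinity>" using assms by (auto simp: proper_def)
  with PInf have "u \<notin> subdifferential f x"
    by (auto simp: subdifferential_def intro!: exI[of _ y])
  then show ?thesis using PInf by simp
qed (use proper_not_MInfty[OF assms] in auto)

section \<open>Duality gap\<close>

lemma weak_duality:
  fixes L :: "'a::{real_inner, complete_space} \<Rightarrow> 'b::real_inner"
  assumes "bounded_linear L" "proper f" "proper g"
  shows "0 \<le> (f x + g (L x)) + (conjugate g y + conjugate f (- adjoint L y))"
proof -
  have "ereal (x \<bullet> - adjoint L y) + ereal (L x \<bullet> y)
      \<le> (f x + conjugate f (- adjoint L y)) + (g (L x) + conjugate g y)"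
    by (intro add_mono fenchel_young assms)
  then show ?thesis
    by (simp add: adjoint_bounded_linear[OF assms(1)] ac_simps zero_ereal_def)
qed

text \<open>
  Each Fenchel--Young inequality holds separately, so their sum can only be an equality of real
  numbers if both of them are.
\<close>

lemma zero_gap_iff_subgradients:
  fixes L :: "'a::{real_inner, complete_space} \<Rightarrow> 'b::real_inner"
  assumes "bounded_linear L" "proper f" "proper g"
  shows "(f x + g (L x)) + (conjugate g y + conjugate f (- adjoint L y)) = 0 \<longleftrightarrow>
    - adjoint L y \<in> subdifferential f x \<and> y \<in> subdifferential g (L x)"
proof -
  define r where "r = L x \<bullet> y"
  have r: "x \<bullet> - adjoint L y = - r"
    by (simp add: r_def adjoint_bounded_linear[OF assms(1)])
  define F where "F = f x + conjugate f (- adjoint L y)"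
  define G where "G = g (L x) + conjugate g y"
  have FG: "ereal (- r) \<le> F" "ereal r \<le> G"
    using fenchel_young[OF assms(2), of x "- adjoint L y"] fenchel_young[OF assms(3), of "L x" y]
    by (simp_all only: r flip: F_def G_def r_def)
  have "(f x + g (L x)) + (conjugate g y + conjugate f (- adjoint L y)) = F + G"
    by (simp add: F_def G_def ac_simps)
  also have "F + G = 0 \<longleftrightarrow> F = ereal (- r) \<and> G = ereal r"
    using FG by (cases F; cases G) auto
  finally show ?thesis
    unfolding subdifferential_iff_fenchel_young_eq[OF assms(2)]
      subdifferential_iff_fenchel_young_eq[OF assms(3)] r
    by (simp add: F_def G_def r_def)
qed

lemma mem_primal_solutions_iff:
  fixes L :: "'a::{real_inner, complete_space} \<Rightarrow> 'b::real_inner"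
  assumes "bounded_linear L" "proper f" "proper g"
  shows "x \<in> primal_solutions f g L \<longleftrightarrow>
    (\<exists>y. (f x + g (L x)) + (conjugate g y + conjugate f (- adjoint L y)) = 0)"
proof -
  have "x \<in> primal_solutions f g L \<longleftrightarrow>
      (\<exists>u\<in>subdifferential f x. \<exists>y\<in>subdifferential g (L x). 0 = u + adjoint L y)"
    by (simp add: primal_solutions_def set_plus_def Bex_def image_iff) metis
  also have "\<dots> \<longleftrightarrow>
      (\<exists>y. - adjoint L y \<in> subdifferential f x \<and> y \<in> subdifferential g (L x))"
    by (metis add.left_inverse eq_neg_iff_add_eq_0)
  finally show ?thesis
    by (simp add: zero_gap_iff_subgradients[OF assms])
qed

text \<open>
  The optimality argument concerns only the inequality \<open>0 \<le> p x + d y\<close>. In \<open>p x + d y = 0\<close>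
  both summands are real, because an infinite summand makes a sum of extended reals infinite.
\<close>

lemma zero_gap_imp_optimal:
  fixes p :: "'a \<Rightarrow> ereal" and d :: "'b \<Rightarrow> ereal"
  assumes weak: "\<And>x y. 0 \<le> p x + d y" and gap: "p x + d y = 0"
  obtains a where "p x = ereal a" "(INF x. p x) = ereal a"
    "d y = ereal (- a)" "(INF y. d y) = ereal (- a)"
proof -
  obtain a where a: "p x = ereal a" "d y = ereal (- a)"
    using gap by (cases "p x"; cases "d y") (auto simp: eq_neg_iff_add_eq_0 add.commute)
  have "p x \<le> p x'" for x'
    using weak[of x' y] a by (cases "p x'") auto
  then have "(INF x. p x) = p x"
    by (intro antisym INF_greatest INF_lower) auto
  moreover have "d y \<le> d y'" for y'
    using weak[of x y'] a by (cases "d y'") auto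
  then have "(INF y. d y) = d y"
    by (intro antisym INF_greatest INF_lower) auto
  ultimately show thesis using that a by simp
qed

lemma argmin_eq_attaining: "argmin h = {x. h x = (INF x. h x)}"
  for h :: "'a \<Rightarrow> ereal"
proof -
  have "(\<forall>y. \<not> h y < h x) \<longleftrightarrow> h x = (INF x. h x)" for x
    by (auto simp: not_less intro!: antisym INF_greatest INF_lower)
  then show ?thesis by (auto simp: argmin_def is_arg_min_def)
qed

section \<open>Total duality\<close>

theorem theorem6p5:
  fixes f :: "'a::{real_inner, complete_space} \<Rightarrow> ereal"
    and g :: "'b::{real_inner, complete_space} \<Rightarrow> ereal"
    and L :: "'a \<Rightarrow> 'b"
  assumes L: "bounded_linear L"
    and f: "convex_fun f" "lsc f" "proper f"
    and g: "convex_fun g" "lsc g" "proper g"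
  shows "(primal_solutions f g L \<noteq> {} \<longleftrightarrow>
            dual_value f g L = - primal_value f g L \<and>
            - primal_value f g L \<in> range ereal \<and>
            (\<exists>x. f x + g (L x) = primal_value f g L) \<and>
            (\<exists>y. conjugate g y + conjugate f (- adjoint L y) = dual_value f g L)) \<and>
         (primal_solutions f g L \<noteq> {} \<longrightarrow>
            primal_solutions f g L = argmin (\<lambda>x. f x + g (L x)))"
proof -
  define p where "p x = f x + g (L x)" for x
  define d where "d y = conjugate g y + conjugate f (- adjoint L y)" for y
  have weak: "0 \<le> p x + d y" for x y
    unfolding p_def d_def by (rule weak_duality[OF L f(3) g(3)])
  have Z: "x \<in> primal_solutions f g L \<longleftrightarrow> (\<exists>y. p x + d y = 0)" for x
    unfolding p_def d_def by (rule mem_primal_solutions_iff[OF L f(3) g(3)])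
  have value_defs: "primal_value f g L = (INF x. p x)" "dual_value f g L = (INF y. d y)"
    by (simp_all add: primal_value_def dual_value_def p_def d_def)
  let ?strong = "(INF y. d y) = - (INF x. p x) \<and> - (INF x. p x) \<in> range ereal \<and>
    (\<exists>x. p x = (INF x. p x)) \<and> (\<exists>y. d y = (INF y. d y))"
  have strong: ?strong if nonempty: "primal_solutions f g L \<noteq> {}"
  proof -
    obtain x y where "p x + d y = 0" using nonempty Z by blast
    then obtain a where "p x = ereal a" "(INF x. p x) = ereal a"
      "d y = ereal (- a)" "(INF y. d y) = ereal (- a)"
      by (rule zero_gap_imp_optimal[of p d, OF weak])
    then show ?thesis
      by (intro conjI exI[of _ x] exI[of _ y]) auto
  qed
  have attaining: "x \<in> primal_solutions f g L" if strong_x: ?strong "p x = (INF x. p x)" for x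
  proof -
    obtain y where y: "d y = (INF y. d y)"
      using strong_x(1) by (elim conjE exE)
    have "d y = - p x"
      using strong_x(1) by (simp only: y strong_x(2))
    moreover have "- p x \<in> range ereal"
      using strong_x(1) by (simp only: strong_x(2))
    ultimately have "p x + d y = 0"
      by (cases "p x") auto
    then show ?thesis using Z by blast
  qed
  have "primal_solutions f g L = argmin p" if "primal_solutions f g L \<noteq> {}"
  proof -
    have "p x = (INF x. p x)" if x: "x \<in> primal_solutions f g L" for x
    proof -
      obtain y where "p x + d y = 0" using x Z by blast
      then show ?thesis
        by (rule zero_gap_imp_optimal[of p d, OF weak]) simp
    qed
    then show ?thesis
      using attaining[OF strong[OF that]] by (auto simp: argmin_eq_attaining)
  qed
  moreover have "primal_solutions f g L \<noteq> {} \<longleftrightarrow> ?strong"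
  proof
    assume strong': ?strong
    then obtain x where "p x = (INF x. p x)" by (elim conjE exE)
    then show "primal_solutions f g L \<noteq> {}"
      using attaining[OF strong'] by auto
  qed (rule strong)
  moreover have "(\<lambda>x. f x + g (L x)) = p"
    by (simp add: p_def fun_eq_iff)
  ultimately show ?thesis
    by (simp only: value_defs flip: p_def d_def) iprover
qed

end
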